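(* Let $N\ge2$, let $\bar u>0$, and let $w_1=w_N=\tfrac12$ and $w_k=1$ for $2\le k\le N-1$. For any $0<\lambda\le1$, the objective $$F(\hat{\mathbf U})=\frac12\hat{\mathbf U}^{\mathsf T}P\hat{\mathbf U}+\sum_{k=1}^N q_k\lVert\hat{\mathbf u}_k\rVert_2+\mathcal I_{\mathcal B}(\hat{\mathbf U}),\qquad \hat{\mathbf U}=[\hat{\mathbf u}_1^{\mathsf T},\ldots,\hat{\mathbf u}_N^{\mathsf T}]^{\mathsf T}\in\mathbb R^{3N},$$ where $P$ is block diagonal with diagonal blocks $P_k=\lambda w_kI_3$, $q_k=\frac{1-\lambda}{2}\bar u\,w_k$, and $\mathcal B=\{\hat{\mathbf U}:\lVert\hat{\mathbf u}_k\rVert_2\le\bar u\ \text{for all }k=1,\ldots,N\}$, is $\mu$-strongly convex with $\mu=\lambda/2$. If the condensed feasible set $\{\hat{\mathbf U}\in\mathcal B: H_c\hat{\mathbf U}=\mathbf h_c\}$ is nonempty, then the optimal control, i.e. the minimizer of $F$ subject to $H_c\hat{\mathbf U}=\mathbf h_c$, is unique.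
   Context: $\mathcal I_{\mathcal B}$ is the convex-analysis indicator function of $\mathcal B$ ($0$ on $\mathcal B$, $+\infty$ outside). A function $F:\mathbb R^{n}\to\mathbb R\cup\{+\infty\}$ is $\mu$-strongly convex if $F-\frac{\mu}{2}\lVert\cdot\rVert_2^2$ is convex. The pair $(H_c,\mathbf h_c)$, $H_c\in\mathbb R^{6\times 3N}$, $\mathbf h_c\in\mathbb R^6$, encodes the terminal condition of a discretized landing problem, as follows. Let $t_f>0$, $\Delta t=t_f/(N-1)$, $\mathbf g\in\mathbb R^3$, $\mathbf x_0,\mathbf x_f\in\mathbb R^6$, and $$A=\begin{bmatrix}I_3&\Delta t I_3\\0&I_3\end{bmatrix},\quad B_0=B_1=\begin{bmatrix}\frac{\Delta t^2}{4}I_3\\ \frac{\Delta t}{2}I_3\end{bmatrix},\quad \mathbf d=\begin{bmatrix}\frac{\Delta t^2}{2}\mathbf g\\ \Delta t\,\mathbf g\end{bmatrix}.$$ Let $P_r,P_v$ be diagonal positive definite $3\times3$ matrices, $S_x=\operatorname{blkdiag}(P_r,P_v)$, and $S_u=s_uI_3$ with $s_u>0$ (and $\bar u=u_{\max}/s_u$ with $u_{\max}>0$ the maximum thrust acceleration). Put $\hat A=S_x^{-1}AS_x$, $\hat B_i=S_x^{-1}B_iS_u$, $\hat{\mathbf d}=S_x^{-1}\mathbf d$, $\hat{\mathbf x}_f=S_x^{-1}\mathbf x_f$. Let $E_k\in\mathbb R^{3\times3N}$ select the $k$th block, $E_k\hat{\mathbf U}=\hat{\mathbf u}_k$, and define $$\hat{\mathbf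 x}^{(0)}_1=S_x^{-1}\mathbf x_0,\quad \Gamma_1=0,\quad \hat{\mathbf x}^{(0)}_{k+1}=\hat A\hat{\mathbf x}^{(0)}_k+\hat{\mathbf d},\quad \Gamma_{k+1}=\hat A\Gamma_k+\hat B_0E_k+\hat B_1E_{k+1}\quad(1\le k\le N-1).$$ Let $G=\Gamma_N$ (with nonzero rows), $D=\operatorname{diag}(1/\lVert G_{1,:}\rVert_2,\ldots,1/\lVert G_{6,:}\rVert_2)$ where $G_{i,:}$ is the $i$th row, $H_c=DG$ and $\mathbf h_c=D(\hat{\mathbf x}_f-\hat{\mathbf x}^{(0)}_N)$. *)

theory Defs
  imports
    "Jordan_Normal_Form.Gauss_Jordan_Elimination"
    "HOL-Analysis.L2_Norm"
    "HOL-Library.Extended_Real"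
begin

definition norm2 :: "real vec \<Rightarrow> real" where
  "norm2 v = L2_set (\<lambda>i. v $ i) {..<dim_vec v}"

definition pos_def_mat :: "nat \<Rightarrow> real mat \<Rightarrow> bool" where
  "pos_def_mat n M \<longleftrightarrow> M \<in> carrier_mat n n \<and> transpose_mat M = M \<and>
     (\<forall>v\<in>carrier_vec n. v \<noteq> 0\<^sub>v n \<longrightarrow> v \<bullet> (M *\<^sub>v v) > 0)"

(* Meaningful only for invertible M. *)
definition minv :: "real mat \<Rightarrow> real mat" where
  "minv M = the (mat_inverse M)"


text \<open>Extended-valued functions on \<open>\<real>\<^sup>n\<close>. The weights are taken in the open unit interval; the
  end points give trivial inequalities.\<close>

definition convex_ext :: "nat \<Rightarrow> (real vec \<Rightarrow> ereal) \<Rightarrow> bool" where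
  "convex_ext n f \<longleftrightarrow>
     (\<forall>x\<in>carrier_vec n. \<forall>y\<in>carrier_vec n. \<forall>t::real. 0 < t \<and> t < 1 \<longrightarrow>
        f (t \<cdot>\<^sub>v x + (1 - t) \<cdot>\<^sub>v y) \<le> ereal t * f x + ereal (1 - t) * f y)"

(* The first conjunct says that f takes values in the reals extended by plus infinity only. *)
definition strongly_convex_ext :: "nat \<Rightarrow> real \<Rightarrow> (real vec \<Rightarrow> ereal) \<Rightarrow> bool" where
  "strongly_convex_ext n \<mu> f \<longleftrightarrow>
     (\<forall>x\<in>carrier_vec n. f x \<noteq> - \<infinity>) \<and>
     convex_ext n (\<lambda>x. f x - ereal (\<mu> / 2 * (norm2 x)\<^sup>2))"

definition indicator_ext :: "'a set \<Rightarrow> 'a \<Rightarrow> ereal" where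
  "indicator_ext S x = (if x \<in> S then 0 else \<infinity>)"


text \<open>A control sequence is a vector in \<open>\<real>\<^sup>3\<^sup>N\<close>, the concatenation of its \<open>N\<close> blocks of length 3.
  Nodes are numbered \<open>1,\<dots>,N\<close>, whereas vector and matrix entries are numbered from 0.\<close>

definition block_sel :: "nat \<Rightarrow> nat \<Rightarrow> real mat" where
  "block_sel N k = mat 3 (3 * N) (\<lambda>(i, j). if j = 3 * (k - 1) + i then 1 else 0)"

definition control :: "nat \<Rightarrow> real vec \<Rightarrow> nat \<Rightarrow> real vec" where
  "control N U k = block_sel N k *\<^sub>v U"


definition dyn_A :: "real \<Rightarrow> real mat" where
  "dyn_A dt = four_block_mat (1\<^sub>m 3) (dt \<cdot>\<^sub>m 1\<^sub>m 3) (0\<^sub>m 3 3) (1\<^sub>m 3)"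

definition dyn_B0 :: "real \<Rightarrow> real mat" where
  "dyn_B0 dt = (dt\<^sup>2 / 4) \<cdot>\<^sub>m 1\<^sub>m 3 @\<^sub>r (dt / 2) \<cdot>\<^sub>m 1\<^sub>m 3"

definition dyn_B1 :: "real \<Rightarrow> real mat" where
  "dyn_B1 dt = dyn_B0 dt"

definition dyn_d :: "real \<Rightarrow> real vec \<Rightarrow> real vec" where
  "dyn_d dt g = (dt\<^sup>2 / 2) \<cdot>\<^sub>v g @\<^sub>v dt \<cdot>\<^sub>v g"

definition state_scaling :: "real mat \<Rightarrow> real mat \<Rightarrow> real mat" where
  "state_scaling Pr Pv = four_block_mat Pr (0\<^sub>m 3 3) (0\<^sub>m 3 3) Pv"

definition scaled_A :: "real mat \<Rightarrow> real \<Rightarrow> real mat" where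
  "scaled_A Sx dt = minv Sx * dyn_A dt * Sx"

definition scaled_B0 :: "real mat \<Rightarrow> real mat \<Rightarrow> real \<Rightarrow> real mat" where
  "scaled_B0 Sx Su dt = minv Sx * dyn_B0 dt * Su"

definition scaled_B1 :: "real mat \<Rightarrow> real mat \<Rightarrow> real \<Rightarrow> real mat" where
  "scaled_B1 Sx Su dt = minv Sx * dyn_B1 dt * Su"

definition scaled_d :: "real mat \<Rightarrow> real \<Rightarrow> real vec \<Rightarrow> real vec" where
  "scaled_d Sx dt g = minv Sx *\<^sub>v dyn_d dt g"

(* Both recursions start at node 1; the value at 0 is unspecified and never used. *)
fun free_state :: "real mat \<Rightarrow> real \<Rightarrow> real vec \<Rightarrow> real vec \<Rightarrow> nat \<Rightarrow> real vec" where
  "free_state Sx dt g x0 (Suc 0) = minv Sx *\<^sub>v x0"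
| "free_state Sx dt g x0 (Suc (Suc k)) =
     scaled_A Sx dt *\<^sub>v free_state Sx dt g x0 (Suc k) + scaled_d Sx dt g"

fun control_mat :: "nat \<Rightarrow> real mat \<Rightarrow> real mat \<Rightarrow> real \<Rightarrow> nat \<Rightarrow> real mat" where
  "control_mat N Sx Su dt (Suc 0) = 0\<^sub>m 6 (3 * N)"
| "control_mat N Sx Su dt (Suc (Suc k)) =
     scaled_A Sx dt * control_mat N Sx Su dt (Suc k)
     + scaled_B0 Sx Su dt * block_sel N (Suc k)
     + scaled_B1 Sx Su dt * block_sel N (Suc (Suc k))"

definition row_normalizer :: "real mat \<Rightarrow> real mat" where
  "row_normalizer M = mat_diag (dim_row M) (\<lambda>i. 1 / norm2 (Matrix.row M i))"


definition weight :: "nat \<Rightarrow> nat \<Rightarrow> real" where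
  "weight N k = (if k = 1 \<or> k = N then 1 / 2 else 1)"

definition control_ball :: "nat \<Rightarrow> real \<Rightarrow> real vec set" where
  "control_ball N ubar = {U \<in> carrier_vec (3 * N). \<forall>k\<in>{1..N}. norm2 (control N U k) \<le> ubar}"

definition cost_mat :: "nat \<Rightarrow> real \<Rightarrow> real mat" where
  "cost_mat N lam = diag_block_mat (map (\<lambda>k. (lam * weight N k) \<cdot>\<^sub>m 1\<^sub>m 3) [1..<N + 1])"

definition objective :: "nat \<Rightarrow> real \<Rightarrow> real \<Rightarrow> real vec \<Rightarrow> ereal" where
  "objective N lam ubar U =
     ereal (1 / 2 * (U \<bullet> (cost_mat N lam *\<^sub>v U))
       + (\<Sum>k = 1..N. (1 - lam) / 2 * ubar * weight N k * norm2 (control N U k)))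
     + indicator_ext (control_ball N ubar) U"

end

theory Submission
  imports Defs
begin

text \<open>All weights are at least \<open>1/2\<close>, so \<open>F\<close> minus \<open>\<lambda>/4\<close> times the squared norm is a nonnegative
  combination of squares of coordinates and of norms of blocks on the ball. For existence and
  uniqueness, strong convexity at midpoints bounds the squared distance of two points by their excess
  over the infimum: minimizing sequences are Cauchy in every coordinate, and two minimizers
  coincide.\<close>

section \<open>Strongly convex functions on closed sets\<close>

text \<open>The dimension of a \<open>vec\<close> belongs to its value and not to its type, so
  convergence is stated on a fixed carrier. Coordinatewise limits agree with norm limits there,
  since \<open>n\<close> is finite.\<close>

definition vec_tendsto :: "nat \<Rightarrow> (nat \<Rightarrow> real vec) \<Rightarrow> real vec \<Rightarrow> bool" where
  "vec_tendsto n X x \<longleftrightarrow>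
     (\<forall>k. X k \<in> carrier_vec n) \<and> x \<in> carrier_vec n \<and> (\<forall>i<n. (\<lambda>k. X k $ i) \<longlonglongrightarrow> x $ i)"

text \<open>Sequential closedness serves twice: for the feasible set, and for sublevel sets, where
  it expresses lower semicontinuity.\<close>

definition vec_seq_closed :: "nat \<Rightarrow> real vec set \<Rightarrow> bool" where
  "vec_seq_closed n C \<longleftrightarrow>
     C \<subseteq> carrier_vec n \<and> (\<forall>X x. vec_tendsto n X x \<longrightarrow> (\<forall>k. X k \<in> C) \<longrightarrow> x \<in> C)"

lemma vec_tendsto_tail: "vec_tendsto n X x \<Longrightarrow> vec_tendsto n (\<lambda>k. X (k + m)) x"
  unfolding vec_tendsto_def using LIMSEQ_ignore_initial_segment by blast

lemma norm2_power2: "(norm2 v)\<^sup>2 = (\<Sum>i<dim_vec v. (v $ i)\<^sup>2)"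
  unfolding norm2_def L2_set_def by (simp add: sum_nonneg)

lemma norm2_nonneg: "0 \<le> norm2 v"
  unfolding norm2_def by simp

lemma abs_index_le_norm2:
  assumes "i < dim_vec v"
  shows "\<bar>v $ i\<bar> \<le> norm2 v"
  using member_le_L2_set[of "{..<dim_vec v}" i "\<lambda>i. \<bar>v $ i\<bar>"] assms
  by (simp add: norm2_def L2_set_def)

text \<open>Convexity of \<open>f\<close> minus its quadratic at weight 1/2, combined with the
  parallelogram law: the midpoint loses a quarter of the squared distance, and \<mu>/2 times 1/4 is
  \<mu>/8.\<close>

lemma strongly_convex_ext_midpoint:
  assumes sc: "strongly_convex_ext n \<mu> f"
    and x: "x \<in> carrier_vec n" and y: "y \<in> carrier_vec n"
    and fx: "f x \<le> ereal a" and fy: "f y \<le> ereal b"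
  shows "f ((1/2) \<cdot>\<^sub>v x + (1/2) \<cdot>\<^sub>v y) \<le> ereal ((a + b) / 2 - \<mu> / 8 * (norm2 (x - y))\<^sup>2)"
proof -
  let ?m = "(1/2) \<cdot>\<^sub>v x + (1/2) \<cdot>\<^sub>v y"
  have m: "?m \<in> carrier_vec n" using x y by simp
  \<comment> \<open>The real upper bound excludes \<infinity>, and strong convexity excludes
    -\<infinity>, so the rest is real arithmetic.\<close>
  obtain a' where a': "f x = ereal a'" "a' \<le> a"
    using fx sc x unfolding strongly_convex_ext_def by (cases "f x") auto
  obtain b' where b': "f y = ereal b'" "b' \<le> b"
    using fy sc y unfolding strongly_convex_ext_def by (cases "f y") auto
  have ineq: "f ?m - ereal (\<mu> / 2 * (norm2 ?m)\<^sup>2)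
      \<le> ereal ((a' - \<mu> / 2 * (norm2 x)\<^sup>2) / 2 + (b' - \<mu> / 2 * (norm2 y)\<^sup>2) / 2)"
  proof -
    have "f ((1/2) \<cdot>\<^sub>v x + (1 - 1/2) \<cdot>\<^sub>v y) - ereal (\<mu> / 2 * (norm2 ((1/2) \<cdot>\<^sub>v x + (1 - 1/2) \<cdot>\<^sub>v y))\<^sup>2)
      \<le> ereal (1/2) * (f x - ereal (\<mu> / 2 * (norm2 x)\<^sup>2))
        + ereal (1 - 1/2) * (f y - ereal (\<mu> / 2 * (norm2 y)\<^sup>2))"
    proof -
      have "(0::real) < 1/2 \<and> (1/2::real) < 1" by simp
      then show ?thesis
        using sc x y unfolding strongly_convex_ext_def convex_ext_def by blast
    qed
    then show ?thesis using a' b' by simp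
  qed
  obtain c where c: "f ?m = ereal c"
    using ineq sc m unfolding strongly_convex_ext_def by (cases "f ?m") auto
  have par: "(norm2 ?m)\<^sup>2 = (norm2 x)\<^sup>2 / 2 + (norm2 y)\<^sup>2 / 2 - (norm2 (x - y))\<^sup>2 / 4"
  proof -
    have "(norm2 ?m)\<^sup>2 = (\<Sum>i<n. ((1/2) * x $ i + (1/2) * y $ i)\<^sup>2)"
      unfolding norm2_power2 using x y by (auto intro!: sum.cong)
    also have "\<dots> = (\<Sum>i<n. (x $ i)\<^sup>2 / 2 + (y $ i)\<^sup>2 / 2 - (x $ i - y $ i)\<^sup>2 / 4)"
      by (intro sum.cong refl) (simp add: power2_eq_square field_simps)
    also have "\<dots> = (norm2 x)\<^sup>2 / 2 + (norm2 y)\<^sup>2 / 2 - (norm2 (x - y))\<^sup>2 / 4"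
      using x y by (simp add: norm2_power2 sum.distrib sum_subtractf sum_divide_distrib)
    finally show ?thesis .
  qed
  have "c - \<mu> / 2 * (norm2 ?m)\<^sup>2
      \<le> (a' - \<mu> / 2 * (norm2 x)\<^sup>2) / 2 + (b' - \<mu> / 2 * (norm2 y)\<^sup>2) / 2"
    using ineq c by simp
  then have "c \<le> (a' + b') / 2 - \<mu> / 8 * (norm2 (x - y))\<^sup>2"
    unfolding par by (simp add: field_simps)
  also have "\<dots> \<le> (a + b) / 2 - \<mu> / 8 * (norm2 (x - y))\<^sup>2"
    using a' b' by (intro diff_right_mono) simp
  finally show ?thesis using c by simp
qed

text \<open>Completeness of the reals takes the place of compactness. The bound \<open>l\<close> and
  the point \<open>z\<close> make the infimum a real number; \<open>sublevel\<close> is lower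
  semicontinuity.\<close>

lemma strongly_convex_ext_ex1_arg_min:
  assumes sc: "strongly_convex_ext n \<mu> f" and mu: "0 < \<mu>"
    and lower: "\<And>x. x \<in> C \<Longrightarrow> ereal l \<le> f x"
    and sublevel: "\<And>c. vec_seq_closed n {x \<in> carrier_vec n. f x \<le> ereal c}"
    and C: "vec_seq_closed n C"
    and mid: "\<And>x y. x \<in> C \<Longrightarrow> y \<in> C \<Longrightarrow> (1/2) \<cdot>\<^sub>v x + (1/2) \<cdot>\<^sub>v y \<in> C"
    and fin: "z \<in> C" "f z \<noteq> \<infinity>"
  shows "\<exists>!x. is_arg_min f (\<lambda>x. x \<in> C) x"
proof -
  have Cn: "x \<in> carrier_vec n" if "x \<in> C" for x
    using C that unfolding vec_seq_closed_def by auto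
  define I where "I = (INF x\<in>C. f x)"
  have "ereal l \<le> I" unfolding I_def by (intro INF_greatest lower)
  moreover have "I \<le> f z" unfolding I_def by (intro INF_lower fin)
  ultimately obtain m where m: "I = ereal m"
    using fin by (cases I) auto
  have m_le: "ereal m \<le> f x" if "x \<in> C" for x
    using that unfolding m[symmetric] I_def by (rule INF_lower)
  \<comment> \<open>Here \<open>a\<close> and \<open>b\<close> bound the excess over the infimum
    \<open>m\<close>. The midpoint stays in \<open>C\<close>, so its value is at least
    \<open>m\<close>, which leaves room only for a small distance.\<close>
  have close: "\<mu> / 8 * (norm2 (x - y))\<^sup>2 \<le> (a + b) / 2"
    if "x \<in> C" "y \<in> C" "f x \<le> ereal (m + a)" "f y \<le> ereal (m + b)" for x y a b
  proof -
    have "ereal m \<le> ereal ((m + a + (m + b)) / 2 - \<mu> / 8 * (norm2 (x - y))\<^sup>2)"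
      using m_le[OF mid[OF that(1,2)]]
        strongly_convex_ext_midpoint[OF sc Cn[OF that(1)] Cn[OF that(2)] that(3,4)]
      by (rule order_trans)
    then show ?thesis by (simp add: field_simps)
  qed
  have "\<exists>x\<in>C. f x \<le> ereal (m + inverse (real (Suc k)))" for k
  proof -
    have "I < ereal (m + inverse (real (Suc k)))" unfolding m by simp
    then show ?thesis unfolding I_def INF_less_iff by (auto intro: less_imp_le)
  qed
  then obtain X where X: "\<And>k. X k \<in> C" "\<And>k. f (X k) \<le> ereal (m + inverse (real (Suc k)))"
    by metis
  have le_half: "p \<le> w" if "p \<le> (u + v) / 2" "u \<le> w" "v \<le> w" for p u v w :: real
    using that by simp
  have "Cauchy (\<lambda>k. X k $ i)" if i: "i < n" for i
  proof (rule metric_CauchyI)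
    fix e :: real assume e: "0 < e"
    \<comment> \<open>This threshold is the excess that \<open>close\<close> converts into a
      distance below \<open>e\<close>; both excesses are at most that of index \<open>K\<close>,
      hence so is their average.\<close>
    then have "0 < \<mu> / 8 * e\<^sup>2" using mu by simp
    then obtain K where K: "inverse (real (Suc K)) < \<mu> / 8 * e\<^sup>2"
      using reals_Archimedean by blast
    show "\<exists>M. \<forall>j\<ge>M. \<forall>k\<ge>M. dist (X j $ i) (X k $ i) < e"
    proof (intro exI allI impI)
      fix j k assume jk: "K \<le> j" "K \<le> k"
      have le: "inverse (real (Suc j)) \<le> inverse (real (Suc K))"
        "inverse (real (Suc k)) \<le> inverse (real (Suc K))"
        using jk by (auto intro!: le_imp_inverse_le)
      have "\<mu> / 8 * (norm2 (X j - X k))\<^sup>2 < \<mu> / 8 * e\<^sup>2"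
        using le_half[OF close[OF X(1) X(1) X(2) X(2)] le] K by (rule le_less_trans)
      then have "(norm2 (X j - X k))\<^sup>2 < e\<^sup>2" using mu by simp
      then have "norm2 (X j - X k) < e" using e by (auto intro: power_less_imp_less_base)
      moreover have "\<bar>(X j - X k) $ i\<bar> \<le> norm2 (X j - X k)"
        using i carrier_vecD[OF Cn[OF X(1)]] by (intro abs_index_le_norm2) simp
      ultimately show "dist (X j $ i) (X k $ i) < e"
        using i Cn[OF X(1), of k] by (simp add: dist_real_def)
    qed
  qed
  then have lims: "\<exists>L. (\<lambda>k. X k $ i) \<longlonglongrightarrow> L" if "i < n" for i
    using that by (simp add: Cauchy_convergent_iff convergent_def)
  define x where "x = vec n (\<lambda>i. lim (\<lambda>k. X k $ i))"
  have Xx: "vec_tendsto n X x"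
    unfolding vec_tendsto_def x_def using lims Cn[OF X(1)]
    by (auto simp: convergent_def convergent_LIMSEQ_iff[symmetric])
  then have xC: "x \<in> C" using C X(1) unfolding vec_seq_closed_def by blast
  have "f x \<le> ereal m"
  proof (rule ereal_le_epsilon2)
    fix e :: real assume "0 < e"
    then obtain K where K: "inverse (real (Suc K)) < e" using reals_Archimedean by blast
    \<comment> \<open>Only a tail of the sequence lies in the sublevel set at \<open>m + e\<close>,
      while closedness speaks of whole sequences; hence the shift by \<open>K\<close>.\<close>
    have "f (X (k + K)) \<le> ereal (m + e)" for k
    proof -
      have "inverse (real (Suc (k + K))) \<le> inverse (real (Suc K))"
        by (intro le_imp_inverse_le) auto
      then have "inverse (real (Suc (k + K))) \<le> e"
        using K by (rule order.trans[OF _ less_imp_le])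
      then have "ereal (m + inverse (real (Suc (k + K)))) \<le> ereal (m + e)" by simp
      then show ?thesis using X(2)[of "k + K"] by (rule order_trans[rotated])
    qed
    then have "x \<in> {x \<in> carrier_vec n. f x \<le> ereal (m + e)}"
      using sublevel[of "m + e"] vec_tendsto_tail[OF Xx, of K] Cn[OF X(1)]
      unfolding vec_seq_closed_def by blast
    then show "f x \<le> ereal m + ereal e" by simp
  qed
  then have min_x: "is_arg_min f (\<lambda>x. x \<in> C) x"
    unfolding is_arg_min_def using xC m_le by (meson leD order_trans)
  moreover have "y = x" if "is_arg_min f (\<lambda>x. x \<in> C) y" for y
  proof -
    have yC: "y \<in> C" and "f y \<le> f x"
      using that xC unfolding is_arg_min_def by (auto simp: not_less)
    \<comment> \<open>Two minimizers both have excess 0, so the estimate behind the Cauchy property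
      also forces them to coincide.\<close>
    then have "\<mu> / 8 * (norm2 (y - x))\<^sup>2 \<le> (0 + 0) / 2"
      using \<open>f x \<le> ereal m\<close> xC by (intro close) auto
    then have n0: "norm2 (y - x) = 0"
      using mu by (simp add: mult_le_0_iff)
    show ?thesis
    proof (rule eq_vecI)
      fix i assume "i < dim_vec x"
      then show "y $ i = x $ i"
        using abs_index_le_norm2[of i "y - x"] n0 by simp
    qed (use Cn[OF yC] Cn[OF xC] in simp)
  qed
  ultimately show ?thesis by blast
qed

text \<open>Each entry of the product is a finite linear combination of coordinates, hence passes to
  the limit; along the sequence it is constant.\<close>

lemma vec_seq_closed_affine:
  assumes A: "A \<in> carrier_mat m n"
  shows "vec_seq_closed n {x \<in> carrier_vec n. A *\<^sub>v x = b}"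
  unfolding vec_seq_closed_def
proof (intro conjI allI impI)
  fix X x assume X: "vec_tendsto n X x" and b: "\<forall>k. X k \<in> {x \<in> carrier_vec n. A *\<^sub>v x = b}"
  have "A *\<^sub>v x = b"
  proof (rule eq_vecI)
    \<comment> \<open>The dimension of \<open>b\<close> is read off from a term of the sequence,
      which solves the equation.\<close>
    show "dim_vec (A *\<^sub>v x) = dim_vec b" using b by auto
    fix i assume "i < dim_vec b"
    then have i: "i < dim_row A" using b by auto
    have "(\<lambda>k. \<Sum>j<n. A $$ (i, j) * X k $ j) \<longlonglongrightarrow> (\<Sum>j<n. A $$ (i, j) * x $ j)"
      using X unfolding vec_tendsto_def by (intro tendsto_intros) auto
    moreover have entry: "(A *\<^sub>v y) $ i = (\<Sum>j<n. A $$ (i, j) * y $ j)" if "y \<in> carrier_vec n" for y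
      using that A i by (auto simp: scalar_prod_def lessThan_atLeast0 intro!: sum.cong)
    moreover have "(\<Sum>j<n. A $$ (i, j) * X k $ j) = b $ i" for k
      using b entry[of "X k"] by auto
    ultimately have "(\<lambda>k. b $ i) \<longlonglongrightarrow> (A *\<^sub>v x) $ i"
      using X unfolding vec_tendsto_def by simp
    then show "(A *\<^sub>v x) $ i = b $ i"
      by (simp add: LIMSEQ_const_iff)
  qed
  then show "x \<in> {x \<in> carrier_vec n. A *\<^sub>v x = b}"
    using X unfolding vec_tendsto_def by simp
qed auto

section \<open>The objective in coordinates\<close>

text \<open>Reduces the quadratic form to a weighted sum of squares. The induction splits off the
  first block; past it, subtracting \<open>d\<close> from an index lowers its block number by
  one.\<close>

lemma index_diag_block_mat_smult_one:
  "diag_block_mat (map (\<lambda>k. c k \<cdot>\<^sub>m (1\<^sub>m d :: real mat)) ks)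
   = mat (d * length ks) (d * length ks) (\<lambda>(i, j). if i = j then c (ks ! (i div d)) else 0)"
proof (induction ks)
  case (Cons k ks)
  show ?case
  proof (rule eq_matI, goal_cases)
    case (1 i j)
    \<comment> \<open>For \<open>d = 0\<close> the matrix is empty, so an index in range rules this
      out.\<close>
    then have "0 < d" by (cases d) auto
    then show ?case using 1
      by (auto simp: Cons.IH Let_def le_div_geq not_less)
  qed (simp_all add: Cons.IH Let_def)
qed (auto simp: Let_def)

section \<open>Blocks of the control vector and the control ball\<close>

lemma control_carrier [simp]: "control N U k \<in> carrier_vec 3"
  unfolding control_def block_sel_def by (simp add: carrier_vecI)

text \<open>Row \<open>i\<close> of the selection matrix has a single one, so the scalar product
  collapses to one term. The offset uses \<open>k - 1\<close> because nodes start at 1 and entries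
  at 0.\<close>

lemma control_index:
  assumes "U \<in> carrier_vec (3 * N)" "k \<in> {1..N}" "i < 3"
  shows "control N U k $ i = U $ (3 * (k - 1) + i)"
proof -
  have lt: "3 * (k - 1) + i < 3 * N" using assms by auto
  have "control N U k $ i = (\<Sum>j\<in>{0..<3 * N}. (if j = 3 * (k - 1) + i then 1 else 0) * U $ j)"
    using assms unfolding control_def block_sel_def
    by (auto simp: scalar_prod_def intro!: sum.cong)
  also have "\<dots> = (\<Sum>j\<in>{0..<3 * N}. if j = 3 * (k - 1) + i then U $ j else 0)"
    by (intro sum.cong) auto
  also have "\<dots> = U $ (3 * (k - 1) + i)"
    using lt by (subst sum.delta) auto
  finally show ?thesis .
qed

lemma norm2_control:
  assumes "U \<in> carrier_vec (3 * N)" "k \<in> {1..N}"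
  shows "norm2 (control N U k) = L2_set (\<lambda>i. U $ (3 * (k - 1) + i)) {..<3}"
  using control_index[OF assms] unfolding norm2_def
  by (auto intro!: L2_set_cong simp: carrier_vecD[OF control_carrier])

lemma control_add_smult:
  assumes "x \<in> carrier_vec (3 * N)" "y \<in> carrier_vec (3 * N)"
  shows "control N (a \<cdot>\<^sub>v x + b \<cdot>\<^sub>v y) k = a \<cdot>\<^sub>v control N x k + b \<cdot>\<^sub>v control N y k"
proof -
  have "block_sel N k \<in> carrier_mat 3 (3 * N)" unfolding block_sel_def by simp
  then show ?thesis
    unfolding control_def using assms
    by (simp add: mult_add_distrib_mat_vec[where nr = 3 and nc = "3 * N"]
        mult_mat_vec[where nr = 3 and nc = "3 * N"])
qed

text \<open>Minkowski's inequality, with the nonnegative factors pulled out of the norms.\<close>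

lemma norm2_convex_comb:
  assumes "dim_vec x = dim_vec y" "0 \<le> a" "0 \<le> b"
  shows "norm2 (a \<cdot>\<^sub>v x + b \<cdot>\<^sub>v y) \<le> a * norm2 x + b * norm2 y"
proof -
  have "norm2 (a \<cdot>\<^sub>v x + b \<cdot>\<^sub>v y) = L2_set (\<lambda>i. a * x $ i + b * y $ i) {..<dim_vec y}"
    using assms(1) unfolding norm2_def by (auto intro!: L2_set_cong)
  also have "\<dots> \<le> L2_set (\<lambda>i. a * x $ i) {..<dim_vec y} + L2_set (\<lambda>i. b * y $ i) {..<dim_vec y}"
    by (rule L2_set_triangle_ineq)
  also have "\<dots> = a * norm2 x + b * norm2 y"
    using assms unfolding norm2_def by (simp add: L2_set_right_distrib)
  finally show ?thesis .
qed

lemma norm2_control_convex: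
  assumes "x \<in> carrier_vec (3 * N)" "y \<in> carrier_vec (3 * N)" "0 \<le> a" "0 \<le> b"
  shows "norm2 (control N (a \<cdot>\<^sub>v x + b \<cdot>\<^sub>v y) k) \<le> a * norm2 (control N x k) + b * norm2 (control N y k)"
  unfolding control_add_smult[OF assms(1,2)]
  using assms by (intro norm2_convex_comb) (simp_all add: carrier_vecD[OF control_carrier])

lemma control_ball_convex:
  assumes "x \<in> control_ball N r" "y \<in> control_ball N r" "0 \<le> a" "0 \<le> b" "a + b = 1"
  shows "a \<cdot>\<^sub>v x + b \<cdot>\<^sub>v y \<in> control_ball N r"
proof -
  have "norm2 (control N (a \<cdot>\<^sub>v x + b \<cdot>\<^sub>v y) k) \<le> r" if k: "k \<in> {1..N}" for k
  proof -
    have "norm2 (control N (a \<cdot>\<^sub>v x + b \<cdot>\<^sub>v y) k) \<le> a * norm2 (control N x k) + b * norm2 (control N y k)"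
      using assms unfolding control_ball_def by (intro norm2_control_convex) auto
    also have "\<dots> \<le> r"
      using assms k by (intro convex_bound_le) (auto simp: control_ball_def)
    finally show ?thesis .
  qed
  then show ?thesis using assms unfolding control_ball_def by auto
qed

lemma tendsto_norm2_control:
  assumes "vec_tendsto (3 * N) X x" "k \<in> {1..N}"
  shows "(\<lambda>m. norm2 (control N (X m) k)) \<longlonglongrightarrow> norm2 (control N x k)"
proof -
  have "(\<lambda>m. X m $ (3 * (k - 1) + i)) \<longlonglongrightarrow> x $ (3 * (k - 1) + i)" if "i < 3" for i
    using assms that unfolding vec_tendsto_def by auto
  then have "(\<lambda>m. L2_set (\<lambda>i. X m $ (3 * (k - 1) + i)) {..<3})
      \<longlonglongrightarrow> L2_set (\<lambda>i. x $ (3 * (k - 1) + i)) {..<3}"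
    unfolding L2_set_def by (intro tendsto_intros) auto
  then show ?thesis using assms by (simp add: norm2_control vec_tendsto_def)
qed

lemma vec_seq_closed_control_ball: "vec_seq_closed (3 * N) (control_ball N r)"
  unfolding vec_seq_closed_def
proof (intro conjI allI impI)
  fix X x assume X: "vec_tendsto (3 * N) X x" and b: "\<forall>m. X m \<in> control_ball N r"
  have "norm2 (control N x k) \<le> r" if k: "k \<in> {1..N}" for k
    using tendsto_norm2_control[OF X k]
    by (rule LIMSEQ_le_const2) (use b k in \<open>auto simp: control_ball_def\<close>)
  then show "x \<in> control_ball N r"
    using X unfolding vec_tendsto_def control_ball_def by simp
qed (auto simp: control_ball_def)

section \<open>Strong convexity and lower semicontinuity of the objective\<close>

definition finite_cost :: "nat \<Rightarrow> real \<Rightarrow> real \<Rightarrow> real vec \<Rightarrow> real" where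
  "finite_cost N lam ubar U = (\<Sum>i<3 * N. lam / 2 * weight N (i div 3 + 1) * (U $ i)\<^sup>2)
     + (\<Sum>k = 1..N. (1 - lam) / 2 * ubar * weight N k * norm2 (control N U k))"

text \<open>Confines extended arithmetic to one case distinction: on the ball all later arguments
  are about a real function.\<close>

lemma objective_eq:
  assumes U: "U \<in> carrier_vec (3 * N)"
  shows "objective N lam ubar U
    = (if U \<in> control_ball N ubar then ereal (finite_cost N lam ubar U) else \<infinity>)"
proof -
  \<comment> \<open>Entry \<open>i\<close> lies in block \<open>i div 3\<close> counted from 0, and
    the list of nodes starts at 1, hence \<open>i div 3 + 1\<close>.\<close>
  have M: "cost_mat N lam
      = mat (3 * N) (3 * N) (\<lambda>(i, j). if i = j then lam * weight N (i div 3 + 1) else 0)"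
    unfolding cost_mat_def index_diag_block_mat_smult_one
    by (rule eq_matI) (auto simp: nth_upt less_mult_imp_div_less mult.commute simp del: upt_Suc)
  have "(cost_mat N lam *\<^sub>v U) $ i = lam * weight N (i div 3 + 1) * U $ i" if i: "i < 3 * N" for i
  proof -
    have "(cost_mat N lam *\<^sub>v U) $ i
        = (\<Sum>j\<in>{0..<3 * N}. (if i = j then lam * weight N (i div 3 + 1) else 0) * U $ j)"
      unfolding M using i U by (simp add: scalar_prod_def)
    also have "\<dots> = (\<Sum>j\<in>{0..<3 * N}. if i = j then lam * weight N (i div 3 + 1) * U $ j else 0)"
      by (intro sum.cong) auto
    also have "\<dots> = lam * weight N (i div 3 + 1) * U $ i"
      using i by (subst sum.delta') auto
    finally show ?thesis .
  qed
  moreover have "dim_vec (cost_mat N lam *\<^sub>v U) = 3 * N" unfolding M by simp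
  ultimately have "1 / 2 * (U \<bullet> (cost_mat N lam *\<^sub>v U))
      = (\<Sum>i<3 * N. lam / 2 * weight N (i div 3 + 1) * (U $ i)\<^sup>2)"
    by (simp add: scalar_prod_def lessThan_atLeast0 sum_divide_distrib power2_eq_square mult_ac)
  then show ?thesis
    unfolding objective_def finite_cost_def indicator_ext_def by simp
qed

text \<open>The source of the modulus: the end nodes attain 1/2, so the smallest diagonal entry of
  the cost matrix is \<open>lam / 2\<close> when \<open>lam\<close> is positive and there is a
  node.\<close>

lemma weight_ge_half: "1 / 2 \<le> weight N k"
  unfolding weight_def by simp

lemma finite_cost_nonneg:
  assumes "0 \<le> lam" "lam \<le> 1" "0 \<le> ubar"
  shows "0 \<le> finite_cost N lam ubar U"
proof -
  have "0 \<le> weight N k" for k using weight_ge_half[of N k] by simp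
  then show ?thesis unfolding finite_cost_def
    using assms by (intro add_nonneg_nonneg sum_nonneg mult_nonneg_nonneg) (auto simp: norm2_nonneg)
qed

lemma finite_cost_strongly_convex:
  assumes x: "x \<in> carrier_vec (3 * N)" and y: "y \<in> carrier_vec (3 * N)"
    and ab: "0 \<le> a" "0 \<le> b" "a + b = 1"
    and lam: "0 \<le> lam" "lam \<le> 1" and ubar: "0 \<le> ubar"
  shows "finite_cost N lam ubar (a \<cdot>\<^sub>v x + b \<cdot>\<^sub>v y) - lam / 4 * (norm2 (a \<cdot>\<^sub>v x + b \<cdot>\<^sub>v y))\<^sup>2
    \<le> a * (finite_cost N lam ubar x - lam / 4 * (norm2 x)\<^sup>2)
      + b * (finite_cost N lam ubar y - lam / 4 * (norm2 y)\<^sup>2)"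
proof -
  \<comment> \<open>What remains of the square coefficients after subtracting half the modulus,
    \<open>lam / 4\<close>. Nonnegativity is exactly the bound 1/2 on the weights.\<close>
  define p where "p i = lam / 2 * weight N (i div 3 + 1) - lam / 4" for i
  define q where "q k = (1 - lam) / 2 * ubar * weight N k" for k
  have split: "finite_cost N lam ubar U - lam / 4 * (norm2 U)\<^sup>2
      = (\<Sum>i<3 * N. p i * (U $ i)\<^sup>2) + (\<Sum>k = 1..N. q k * norm2 (control N U k))"
    if "U \<in> carrier_vec (3 * N)" for U
    using that unfolding finite_cost_def p_def q_def
    by (simp add: norm2_power2 sum_distrib_left left_diff_distrib sum_subtractf)
  have p: "0 \<le> p i" for i
    using mult_left_mono[OF weight_ge_half[of N "i div 3 + 1"], of "lam / 2"] lam
    unfolding p_def by simp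
  have q: "0 \<le> q k" for k
    using weight_ge_half[of N k] lam ubar unfolding q_def by simp
  \<comment> \<open>Convexity of the square: the defect equals \<open>a * b * (r - s)\<close> with
    the last factor squared.\<close>
  have sq: "(a * r + b * s)\<^sup>2 \<le> a * r\<^sup>2 + b * s\<^sup>2" for r s :: real
  proof -
    have b: "b = 1 - a" using ab by simp
    have "a * r\<^sup>2 + b * s\<^sup>2 - (a * r + b * s)\<^sup>2 = a * b * (r - s)\<^sup>2"
      unfolding b by (simp add: power2_eq_square algebra_simps)
    then show ?thesis using ab by (smt (verit) mult_nonneg_nonneg zero_le_power2)
  qed
  have "(\<Sum>i<3 * N. p i * ((a \<cdot>\<^sub>v x + b \<cdot>\<^sub>v y) $ i)\<^sup>2)
      \<le> (\<Sum>i<3 * N. p i * (a * (x $ i)\<^sup>2 + b * (y $ i)\<^sup>2))"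
    using x y p sq by (intro sum_mono mult_left_mono) auto
  also have "\<dots> = a * (\<Sum>i<3 * N. p i * (x $ i)\<^sup>2) + b * (\<Sum>i<3 * N. p i * (y $ i)\<^sup>2)"
    by (simp add: sum.distrib sum_distrib_left algebra_simps)
  finally have 1: "(\<Sum>i<3 * N. p i * ((a \<cdot>\<^sub>v x + b \<cdot>\<^sub>v y) $ i)\<^sup>2) \<le> \<dots>" .
  have "(\<Sum>k = 1..N. q k * norm2 (control N (a \<cdot>\<^sub>v x + b \<cdot>\<^sub>v y) k))
      \<le> (\<Sum>k = 1..N. q k * (a * norm2 (control N x k) + b * norm2 (control N y k)))"
    using norm2_control_convex[OF x y ab(1,2)] q by (intro sum_mono mult_left_mono) auto
  also have "\<dots> = a * (\<Sum>k = 1..N. q k * norm2 (control N x k))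
      + b * (\<Sum>k = 1..N. q k * norm2 (control N y k))"
    by (simp add: sum.distrib sum_distrib_left algebra_simps)
  finally show ?thesis
    using 1 x y by (simp only: split add_carrier_vec smult_carrier_vec) (simp add: distrib_left)
qed

lemma objective_strongly_convex:
  assumes "0 \<le> lam" "lam \<le> 1" "0 \<le> ubar"
  shows "strongly_convex_ext (3 * N) (lam / 2) (objective N lam ubar)"
  unfolding strongly_convex_ext_def convex_ext_def
proof (intro conjI ballI allI impI)
  fix x y :: "real vec" and t :: real
  assume x: "x \<in> carrier_vec (3 * N)" and y: "y \<in> carrier_vec (3 * N)"
    and t: "0 < t \<and> t < 1"
  let ?z = "t \<cdot>\<^sub>v x + (1 - t) \<cdot>\<^sub>v y"
  have z: "?z \<in> carrier_vec (3 * N)" using x y by simp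
  show "objective N lam ubar ?z - ereal (lam / 2 / 2 * (norm2 ?z)\<^sup>2)
    \<le> ereal t * (objective N lam ubar x - ereal (lam / 2 / 2 * (norm2 x)\<^sup>2))
      + ereal (1 - t) * (objective N lam ubar y - ereal (lam / 2 / 2 * (norm2 y)\<^sup>2))"
  proof (cases "x \<in> control_ball N ubar \<and> y \<in> control_ball N ubar")
    case True
    then have "?z \<in> control_ball N ubar" using t by (intro control_ball_convex) auto
    then show ?thesis
      using True t finite_cost_strongly_convex[OF x y, of t "1 - t" lam ubar] assms
      by (simp add: objective_eq[OF x] objective_eq[OF y] objective_eq[OF z])
  next
    \<comment> \<open>A point outside the ball makes the right-hand side \<infinity>: both weights
      are positive and neither summand is -\<infinity>.\<close>
    case False
    then show ?thesis using t by (auto simp: objective_eq[OF x] objective_eq[OF y])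
  qed
qed (simp add: objective_eq)

text \<open>A finite bound forces membership in the ball; the ball is closed, and on it the
  objective is a continuous function of the coordinates.\<close>

lemma vec_seq_closed_objective_sublevel:
  "vec_seq_closed (3 * N) {x \<in> carrier_vec (3 * N). objective N lam ubar x \<le> ereal c}"
  unfolding vec_seq_closed_def
proof (intro conjI allI impI)
  fix X x assume X: "vec_tendsto (3 * N) X x"
    and b: "\<forall>k. X k \<in> {x \<in> carrier_vec (3 * N). objective N lam ubar x \<le> ereal c}"
  have Xk: "X k \<in> control_ball N ubar \<and> finite_cost N lam ubar (X k) \<le> c" for k
    using b[rule_format, of k] by (auto simp: objective_eq split: if_splits)
  have "x \<in> control_ball N ubar"
    using vec_seq_closed_control_ball X Xk unfolding vec_seq_closed_def by blast
  moreover have "(\<lambda>m. finite_cost N lam ubar (X m)) \<longlonglongrightarrow> finite_cost N lam ubar x"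
    unfolding finite_cost_def using X tendsto_norm2_control[OF X]
    by (intro tendsto_intros) (auto simp: vec_tendsto_def)
  then have "finite_cost N lam ubar x \<le> c"
    by (rule LIMSEQ_le_const2) (use Xk in auto)
  ultimately show "x \<in> {x \<in> carrier_vec (3 * N). objective N lam ubar x \<le> ereal c}"
    using X by (simp add: objective_eq vec_tendsto_def)
qed auto

section \<open>Minimization under the terminal condition\<close>

lemma dim_col_control_mat: "2 \<le> N \<Longrightarrow> dim_col (control_mat N Sx Su dt N) = 3 * N"
  \<comment> \<open>The recursive equation applies to \<open>N\<close>, and a matrix sum takes its
    dimensions from the right summand, here a product ending in a selection matrix; so no induction
    is required.\<close>
  unfolding numeral_2_eq_2 by (auto simp: Suc_le_eq block_sel_def dest!: less_imp_Suc_add)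

text \<open>The ball is absent from the constraint because the objective is \<infinity> outside it;
  the feasible point \<open>U0\<close> supplies a finite value.\<close>

lemma objective_ex1_arg_min_affine:
  assumes A: "A \<in> carrier_mat m (3 * N)" and lam: "0 < lam" "lam \<le> 1" and ubar: "0 \<le> ubar"
    and feas: "U0 \<in> control_ball N ubar" "A *\<^sub>v U0 = b"
  shows "\<exists>!U. is_arg_min (objective N lam ubar) (\<lambda>U. U \<in> carrier_vec (3 * N) \<and> A *\<^sub>v U = b) U"
proof -
  let ?C = "{U \<in> carrier_vec (3 * N). A *\<^sub>v U = b}"
  have U0: "U0 \<in> carrier_vec (3 * N)" using feas unfolding control_ball_def by simp
  have "\<exists>!U. is_arg_min (objective N lam ubar) (\<lambda>U. U \<in> ?C) U"
  \<comment> \<open>The lower bound 0 comes from nonnegative coefficients on the ball and the value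
    \<infinity> elsewhere.\<close>
  proof (rule strongly_convex_ext_ex1_arg_min[where l = 0 and z = U0])
    show "strongly_convex_ext (3 * N) (lam / 2) (objective N lam ubar)"
      using lam ubar by (intro objective_strongly_convex) auto
    show "ereal 0 \<le> objective N lam ubar U" if "U \<in> ?C" for U
      using that finite_cost_nonneg lam ubar by (simp add: objective_eq)
    show "(1/2) \<cdot>\<^sub>v x + (1/2) \<cdot>\<^sub>v y \<in> ?C" if "x \<in> ?C" "y \<in> ?C" for x y
    proof -
      have b: "b \<in> carrier_vec m" using feas(2) A U0 by auto
      have "A *\<^sub>v ((1/2) \<cdot>\<^sub>v x + (1/2) \<cdot>\<^sub>v y) = (1/2) \<cdot>\<^sub>v b + (1/2) \<cdot>\<^sub>v b"
        using that by (simp add: mult_add_distrib_mat_vec[OF A] mult_mat_vec[OF A])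
      also have "\<dots> = b" using b by (intro eq_vecI) auto
      finally show ?thesis using that by simp
    qed
  qed (use U0 feas lam in \<open>auto simp: objective_eq vec_seq_closed_objective_sublevel
      vec_seq_closed_affine[OF A]\<close>)
  then show ?thesis by simp
qed

theorem proposition2:
  fixes N :: nat
    and lam tf dt su umax ubar :: real
    and g x0 xf hc :: "real vec"
    and Pr Pv Sx Su G D Hc :: "real mat"
  assumes "N \<ge> 2"
    and "tf > 0" and "dt = tf / (real N - 1)"
    and "g \<in> carrier_vec 3" and "x0 \<in> carrier_vec 6" and "xf \<in> carrier_vec 6"
    and "diagonal_mat Pr" and "pos_def_mat 3 Pr"
    and "diagonal_mat Pv" and "pos_def_mat 3 Pv"
    and "Sx = state_scaling Pr Pv"
    and "su > 0" and "Su = su \<cdot>\<^sub>m 1\<^sub>m 3"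
    and "umax > 0" and "ubar = umax / su" and "ubar > 0"
    and "G = control_mat N Sx Su dt N"
    and "\<forall>i<6. Matrix.row G i \<noteq> 0\<^sub>v (3 * N)"
    and "D = row_normalizer G"
    and "Hc = D * G"
    and "hc = D *\<^sub>v (minv Sx *\<^sub>v xf - free_state Sx dt g x0 N)"
    and "0 < lam" and "lam \<le> 1"
  shows "strongly_convex_ext (3 * N) (lam / 2) (objective N lam ubar) \<and>
    ({U \<in> control_ball N ubar. Hc *\<^sub>v U = hc} \<noteq> {} \<longrightarrow>
      (\<exists>!U. is_arg_min (objective N lam ubar)
              (\<lambda>U. U \<in> carrier_vec (3 * N) \<and> Hc *\<^sub>v U = hc) U))"
proof (intro conjI impI)
  show "strongly_convex_ext (3 * N) (lam / 2) (objective N lam ubar)"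
    using assms by (intro objective_strongly_convex) auto
next
  assume "{U \<in> control_ball N ubar. Hc *\<^sub>v U = hc} \<noteq> {}"
  then obtain U0 where "U0 \<in> control_ball N ubar" "Hc *\<^sub>v U0 = hc" by blast
  \<comment> \<open>The product \<open>D * G\<close> inherits its column count from
    \<open>G\<close>.\<close>
  moreover have "Hc \<in> carrier_mat (dim_row Hc) (3 * N)"
    using assms dim_col_control_mat by (auto intro: carrier_matI)
  ultimately show "\<exists>!U. is_arg_min (objective N lam ubar)
      (\<lambda>U. U \<in> carrier_vec (3 * N) \<and> Hc *\<^sub>v U = hc) U"
    using \<open>0 < lam\<close> \<open>lam \<le> 1\<close> \<open>0 < ubar\<close> by (intro objective_ex1_arg_min_affine) auto
qed

end
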